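(* Let $G$ be a topological group, let $X$ be a finite-dimensional Banach space over $\mathbb{K}\in\{\mathbb{R},\mathbb{C}\}$, and let $W:G\times G\to\mathbb{B}_X$ be a partial cotranslation. Then $\operatorname{rank}W(g,h)=\operatorname{rank}W(k,\ell)$ for every $g,h,k,\ell\in G$.
   Context: $\mathbb{B}_X$ is the algebra of continuous linear operators on $X$. A function $W:G\times G\to\mathbb{B}_X$ is a partial cotranslation if $W(g,kh)=W(hg,k)\circ W(g,h)$ for all $g,h,k\in G$. *)

theory Defs
  imports Complex_Main
begin

text \<open>
  The scalar fields \<open>\<real>\<close> and \<open>\<complex>\<close>, treated uniformly.  The norm needs no further axiom:
  a multiplicative real-homogeneous norm on \<open>\<real>\<close> or \<open>\<complex>\<close> is the usual absolute value.
\<close>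

class real_or_complex = real_normed_field +
  assumes real_or_complex:
    "(\<forall>z. \<exists>a. z = a *\<^sub>R 1) \<or>
     (\<exists>i. i * i = - 1 \<and> (\<forall>z. \<exists>a b. z = a *\<^sub>R 1 + b *\<^sub>R i))"

instance real :: real_or_complex
  by standard simp

instance complex :: real_or_complex
proof
  have "\<exists>a b. z = a *\<^sub>R 1 + b *\<^sub>R \<i>" for z :: complex
    by (rule exI[of _ "Re z"], rule exI[of _ "Im z"]) (simp add: complex_eq_iff)
  then show "(\<forall>z::complex. \<exists>a. z = a *\<^sub>R 1) \<or>
     (\<exists>i::complex. i * i = - 1 \<and> (\<forall>z. \<exists>a b. z = a *\<^sub>R 1 + b *\<^sub>R i))"
    by (intro disjI2 exI[of _ "\<i>"]) simp
qed

text \<open>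
  Class \<^class>\<open>banach\<close> only knows real scalars, so multiplication by \<open>'k\<close> is an explicit
  operation; the \<^class>\<open>banach\<close> structure is the one obtained by restricting scalars.
\<close>

locale banach_space_over = vector_space scale
  for scale :: "'k::real_or_complex \<Rightarrow> 'x::banach \<Rightarrow> 'x" +
  assumes scale_of_real: "scale (of_real r) x = r *\<^sub>R x"
    and norm_scale: "norm (scale c x) = norm c * norm x"

definition continuous_operators ::
    "('k::real_or_complex \<Rightarrow> 'x::banach \<Rightarrow> 'x) \<Rightarrow> ('x \<Rightarrow> 'x) set"
  where "continuous_operators scale =
    {T. Vector_Spaces.linear scale scale T \<and> continuous_on UNIV T}"

definition operator_rank ::
    "('k::real_or_complex \<Rightarrow> 'x::banach \<Rightarrow> 'x) \<Rightarrow> ('x \<Rightarrow> 'x) \<Rightarrow> nat"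
  where "operator_rank scale T = vector_space.dim scale (range T)"

text \<open>
  The library's topological groups are written additively but need not be commutative: the
  group product \<open>k h\<close> is \<open>k + h\<close>, in this order.
\<close>

definition partial_cotranslation ::
    "('k::real_or_complex \<Rightarrow> 'x::banach \<Rightarrow> 'x) \<Rightarrow>
     ('g::topological_group_add \<times> 'g \<Rightarrow> 'x \<Rightarrow> 'x) \<Rightarrow> bool"
  where "partial_cotranslation scale W \<longleftrightarrow>
    range W \<subseteq> continuous_operators scale \<and>
    (\<forall>g h k. W (g, k + h) = W (h + g, k) \<circ> W (g, h))"

end

theory Submission
  imports Defs
begin

text \<open>
  The cotranslation identity, applied twice, factors \<open>W (k, l)\<close> as \<open>A \<circ> W (g, h) \<circ> B\<close>
  with \<open>A\<close> and \<open>B\<close> in the range of \<open>W\<close>: write \<open>l = v + h + u\<close> with \<open>u + k = g\<close>.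
  Hence no rank exceeds another.
\<close>

text \<open>The range of \<open>S \<circ> T\<close> lies in that of \<open>S\<close>. Monotonicity
  of \<open>dim\<close> uses finite dimension: an infinite basis would have \<open>card\<close>
  0.\<close>

lemma operator_rank_comp_right_le:
  assumes "finite_dimensional_vector_space scale Basis"
  shows "operator_rank scale (S \<circ> T) \<le> operator_rank scale S"
proof -
  interpret finite_dimensional_vector_space scale Basis by (fact assms)
  show ?thesis
    unfolding operator_rank_def by (rule dim_subset) auto
qed

text \<open>The range of \<open>S \<circ> T\<close> is the image under \<open>S\<close> of the range
  of \<open>T\<close>, and a linear map cannot raise dimension.\<close>

lemma operator_rank_comp_left_le:
  assumes "finite_dimensional_vector_space scale Basis"
    and "Vector_Spaces.linear scale scale S"
  shows "operator_rank scale (S \<circ> T) \<le> operator_rank scale T"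
proof -
  interpret finite_dimensional_vector_space scale Basis by (fact assms(1))
  interpret finite_dimensional_vector_space_pair_1 scale Basis scale ..
  show ?thesis
    unfolding operator_rank_def image_comp[symmetric] by (rule dim_image_le) (fact assms(2))
qed

lemma partial_cotranslation_operator_rank_le:
  assumes fin: "finite_dimensional_vector_space scale Basis"
    and W: "partial_cotranslation scale W"
  shows "operator_rank scale (W (k, l)) \<le> operator_rank scale (W (g, h))"
proof -
  \<comment> \<open>Left translation by \<open>u\<close> moves the base point \<open>k\<close> to
    \<open>g\<close>. In \<open>v\<close>, the terms \<open>u\<close> and then \<open>h\<close> are
    cancelled from the right of \<open>l\<close>; the order matters, as the group need not be
    commutative.\<close>
  define u where "u = g - k"
  define v where "v = l - u - h"
  have cot: "W (a, c + b) = W (b + a, c) \<circ> W (a, b)" for a b c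
    using W by (simp add: partial_cotranslation_def)
  have "l = (v + h) + u"
    by (simp add: v_def)
  then have "W (k, l) = W (u + k, v + h) \<circ> W (k, u)"
    by (simp only: cot)
  moreover have "u + k = g"
    by (simp add: u_def)
  \<comment> \<open>The identity is now used at base point \<open>g\<close> to split
    \<open>v + h\<close>.\<close>
  ultimately have "W (k, l) = W (h + g, v) \<circ> (W (g, h) \<circ> W (k, u))"
    by (simp only: cot comp_assoc)
  moreover have "Vector_Spaces.linear scale scale (W (h + g, v))"
    using W by (auto simp: partial_cotranslation_def continuous_operators_def)
  ultimately have "operator_rank scale (W (k, l)) \<le> operator_rank scale (W (g, h) \<circ> W (k, u))"
    using operator_rank_comp_left_le[OF fin] by simp
  also have "\<dots> \<le> operator_rank scale (W (g, h))"
    by (rule operator_rank_comp_right_le[OF fin])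
  finally show ?thesis .
qed

theorem proposition5p4:
  fixes scale :: "'k::real_or_complex \<Rightarrow> 'x::banach \<Rightarrow> 'x"
    and Basis :: "'x set"
    and W :: "'g::topological_group_add \<times> 'g \<Rightarrow> 'x \<Rightarrow> 'x"
    and g h k l :: 'g
  assumes "banach_space_over scale"
    and "finite_dimensional_vector_space scale Basis"
    and "partial_cotranslation scale W"
  shows "operator_rank scale (W (g, h)) = operator_rank scale (W (k, l))"
  \<comment> \<open>Both inequalities are the same bound with the two pairs exchanged.\<close>
  using assms(2,3) by (intro antisym partial_cotranslation_operator_rank_le)

end
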